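(* Let $q,n,d$ be positive integers with $d\le n$ and $q\ge2$. Then $$ A_q(n,d)\ \ge\ \frac{q^n}{V_q(n,d-1)}\cdot\frac{\log_2 V_q(n,d-1)-\log_2\sqrt{e_q(n,d-1)}}{10}, $$ where $V_q$ and $e_q$ are as defined in the context.
   Context: $A_q(n,d)$ is the maximum number of codewords in a code of length $n$ and minimum Hamming distance $d$ over an alphabet of $q$ letters. $V_q(n,r)=\sum_{i=0}^{r}\binom{n}{i}(q-1)^i$. For positive integers $r\le n$, $$ e_q(n,r)=\frac16\sum_{w=1}^{r}\sum_{i=1}^{r}\sum_{j=0}^{a}\sum_{k=b}^{a-j}\frac{n!\,(q-2)^k(q-1)^{w+i-c}}{j!\,k!\,(w-c)!\,(i-c)!\,(n+c-w-i)!}\;-\;\frac{V_q(n,r)-1}{6}, $$ where $a=\min\{w,i\}$, $c=j+k$, and $b$ is the smallest nonnegative integer greater than or equal to $(w+i)-j-\min\{r+j,n\}$ (with the convention $0^0=1$ when $q=2$). *)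

theory Defs
  imports Complex_Main
begin

definition words :: "nat \<Rightarrow> nat \<Rightarrow> nat list set" where
  "words q n = {x. length x = n \<and> set x \<subseteq> {..<q}}"

definition hamming_dist :: "'a list \<Rightarrow> 'a list \<Rightarrow> nat" where
  "hamming_dist x y = card {i. i < length x \<and> x ! i \<noteq> y ! i}"

text \<open>Only meaningful for codes with at least two codewords.\<close>

definition min_dist :: "'a list set \<Rightarrow> nat" where
  "min_dist C = Min {hamming_dist x y | x y. x \<in> C \<and> y \<in> C \<and> x \<noteq> y}"

text \<open>
  The minimum distance is required to be exactly \<open>d\<close>, which gives the same maximum as asking
  for at least \<open>d\<close> whenever \<open>1 \<le> d \<le> n\<close> and \<open>2 \<le> q\<close>. In that range the set below is finite
  and nonempty, so \<open>Max\<close> is a genuine maximum.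
\<close>

definition A :: "nat \<Rightarrow> nat \<Rightarrow> nat \<Rightarrow> nat" where
  "A q n d = Max {card C | C. C \<subseteq> words q n \<and> 2 \<le> card C \<and> min_dist C = d}"

definition V :: "nat \<Rightarrow> nat \<Rightarrow> nat \<Rightarrow> nat" where
  "V q n r = (\<Sum>i=0..r. (n choose i) * (q - 1) ^ i)"

text \<open>
  All subtractions are on natural numbers. The one defining \<open>b\<close> truncates on purpose: it yields
  the smallest nonnegative integer that is at least \<open>(w + i) - j - min (r + j) n\<close>. The others
  are exact for \<open>2 \<le> q\<close>; in particular \<open>b \<le> k\<close> forces \<open>w + i \<le> n + c\<close>, and \<open>c \<le> min w i\<close>.

  For \<open>r \<le> n\<close> and \<open>2 \<le> q\<close> the value is \<open>0\<close> exactly if \<open>r = 0\<close> (where all sums are empty) or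
  \<open>q = 2\<close> and \<open>r = 1\<close>; there \<open>log 2 (sqrt (e q n r))\<close> is \<open>0\<close> by the convention \<open>ln 0 = 0\<close>.
\<close>

definition e :: "nat \<Rightarrow> nat \<Rightarrow> nat \<Rightarrow> real" where
  "e q n r =
    1 / 6 * (\<Sum>w=1..r. \<Sum>i=1..r.
      let a = min w i in
      \<Sum>j=0..a.
        let b = (w + i) - j - min (r + j) n in
        \<Sum>k=b..a - j.
          let c = j + k in
          fact n * real (q - 2) ^ k * real (q - 1) ^ (w + i - c) /
          (fact j * fact k * fact (w - c) * fact (i - c) * fact (n + c - w - i)))
    - (real (V q n r) - 1) / 6"

end

(*
  Join two distinct words when their distance is at most r = d - 1. Codes of minimum distance at
  least d are the independent sets of this (V - 1)-regular graph, and every neighbourhood spans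
  3 e edges, because the sum in e counts the ordered pairs in a punctured ball of radius r that are
  at distance at most r, the pairs (y, y) included.

  A large independent set comes from the hard-core model with fugacity l = 1 / (8 sqrt e): choose
  an independent set S with probability proportional to l ^ |S|. Given the part of S outside the
  closed neighbourhood of v, let Y be the set of neighbours of v that are still available. If
  |Y| is small, then v itself is in S with good probability. If |Y| is large, then S contains many
  elements of Y in expectation, since Y spans at most 3 e edges and so l^2 e is a bounded number of
  conflicts. Either way V * P(v in S) + E |S meet N(v)| is at least log_2 (V / sqrt e) / 5, and
  summing over v bounds 2 V E |S| from below. If V / sqrt e is at most 2^10, then the Gilbert
  bound, given by any maximal independent set, is enough.
*)
theory Submission
  imports Defs "HOL-Combinatorics.Multiset_Permutations"
begin

subsection \<open>Independent sets in locally sparse graphs\<close>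

definition indep_sets :: "('a \<Rightarrow> 'a \<Rightarrow> bool) \<Rightarrow> 'a set \<Rightarrow> 'a set set" where
  "indep_sets adj X = {S. S \<subseteq> X \<and> (\<forall>x\<in>S. \<forall>y\<in>S. \<not> adj x y)}"

lemma finite_indep_sets: "finite X \<Longrightarrow> finite (indep_sets adj X)"
  unfolding indep_sets_def by auto

lemma empty_in_indep_sets: "{} \<in> indep_sets adj X"
  unfolding indep_sets_def by auto

text \<open>Dropping the independence constraint leaves the sum over all subsets, which factors over
  the vertices.\<close>

lemma hard_core_partition_le:
  fixes l :: real
  assumes "finite X" "0 \<le> l"
  shows "(\<Sum>S\<in>indep_sets adj X. l ^ card S) \<le> (1 + l) ^ card X"
proof -
  have "(\<Sum>S\<in>indep_sets adj X. l ^ card S) \<le> (\<Sum>S\<in>Pow X. l ^ card S)"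
    by (rule sum_mono2) (use assms in \<open>auto simp: indep_sets_def\<close>)
  also have "\<dots> = (\<Prod>x\<in>X. l + 1)"
    using assms(1) by (subst prod_add) auto
  finally show ?thesis by (simp add: add.commute)
qed

lemma hard_core_partition_ge_1:
  fixes l :: real
  assumes "finite X" "0 \<le> l"
  shows "1 \<le> (\<Sum>S\<in>indep_sets adj X. l ^ card S)"
  using member_le_sum[of "{}" "indep_sets adj X" "\<lambda>S. l ^ card S"] assms
  by (simp add: finite_indep_sets empty_in_indep_sets)

text \<open>Inserting \<open>u\<close> is a bijection from the independent sets that neither contain
  \<open>u\<close> nor block it onto those that contain \<open>u\<close>, and it multiplies the
  weight by \<open>l\<close>.\<close>

lemma hard_core_occupied:
  fixes l :: real
  assumes fin: "finite X" and irr: "\<And>x. \<not> adj x x" and sym: "\<And>x y. adj x y \<Longrightarrow> adj y x"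
    and u: "u \<in> X"
  shows "(\<Sum>S\<in>indep_sets adj X. of_bool (u \<in> S) * l ^ card S)
     = l * (\<Sum>S\<in>indep_sets adj X. of_bool (u \<notin> S \<and> (\<forall>w\<in>S. \<not> adj u w)) * l ^ card S)"
proof -
  let ?I = "indep_sets adj X"
  let ?F = "{S \<in> ?I. u \<notin> S \<and> (\<forall>w\<in>S. \<not> adj u w)}"
  have fI: "finite ?I" using fin by (rule finite_indep_sets)
  have finS: "finite S" if "S \<in> ?I" for S
    using that fin finite_subset unfolding indep_sets_def by auto
  have bij: "bij_betw (insert u) ?F {S \<in> ?I. u \<in> S}"
  proof (rule bij_betwI[where g = "\<lambda>S. S - {u}"])
    show "insert u \<in> ?F \<rightarrow> {S \<in> ?I. u \<in> S}"
      using u irr sym unfolding indep_sets_def by auto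
    show "(\<lambda>S. S - {u}) \<in> {S \<in> ?I. u \<in> S} \<rightarrow> ?F"
      unfolding indep_sets_def by auto
  qed auto
  have "(\<Sum>S\<in>?I. of_bool (u \<in> S) * l ^ card S) = (\<Sum>S\<in>{S \<in> ?I. u \<in> S}. l ^ card S)"
    by (rule sum.mono_neutral_cong_right) (use fI in auto)
  also have "\<dots> = (\<Sum>S\<in>?F. l ^ card (insert u S))"
    by (rule sum.reindex_bij_betw[OF bij, symmetric])
  also have "\<dots> = (\<Sum>S\<in>?F. l * l ^ card S)"
    by (rule sum.cong) (use finS in auto)
  also have "\<dots> = l * (\<Sum>S\<in>?F. l ^ card S)"
    by (simp add: sum_distrib_left)
  also have "(\<Sum>S\<in>?F. l ^ card S) = (\<Sum>S\<in>?I. of_bool (u \<notin> S \<and> (\<forall>w\<in>S. \<not> adj u w)) * l ^ card S)"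
    by (rule sum.mono_neutral_cong_left) (use fI in auto)
  finally show ?thesis .
qed

text \<open>For every independent set, a vertex \<open>u\<close> is occupied, is free, or has an
  occupied neighbour. A union bound over these cases bounds the weight with which \<open>u\<close>
  is occupied from below in terms of its degree; summing over \<open>u\<close> turns degrees into
  ordered adjacent pairs and occupation into mean size.\<close>

lemma hard_core_mean_size_ge:
  fixes l :: real
  assumes fin: "finite X" and irr: "\<And>x. \<not> adj x x" and sym: "\<And>x y. adj x y \<Longrightarrow> adj y x"
    and l: "0 \<le> l"
  shows "l * (\<Sum>S\<in>indep_sets adj X. l ^ card S) *
       (real (card X) - l * real (card {(x, y). x \<in> X \<and> y \<in> X \<and> adj x y}))
     \<le> (1 + l) * (\<Sum>S\<in>indep_sets adj X. l ^ card S * real (card S))"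
proof -
  let ?I = "indep_sets adj X"
  define Z where "Z = (\<Sum>S\<in>?I. l ^ card S)"
  define O1 where "O1 u = (\<Sum>S\<in>?I. of_bool (u \<in> S) * l ^ card S)" for u
  define F where "F u = (\<Sum>S\<in>?I. of_bool (u \<notin> S \<and> (\<forall>w\<in>S. \<not> adj u w)) * l ^ card S)" for u
  define nb where "nb u = {w \<in> X. adj u w}" for u
  have OF1: "O1 u = l * F u" if "u \<in> X" for u
    unfolding O1_def F_def by (rule hard_core_occupied) (use assms that in auto)
  have FZ: "F u \<le> Z" for u
    unfolding F_def Z_def by (rule sum_mono) (use l in auto)
  have finnb: "finite (nb u)" for u using fin unfolding nb_def by auto
  have cover: "Z \<le> O1 u + F u + (\<Sum>w\<in>nb u. O1 w)" for u
  proof -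
    have "Z \<le> (\<Sum>S\<in>?I. (of_bool (u \<in> S) + of_bool (u \<notin> S \<and> (\<forall>w\<in>S. \<not> adj u w))
                 + (\<Sum>w\<in>nb u. of_bool (w \<in> S))) * l ^ card S)"
      unfolding Z_def
    proof (rule sum_mono)
      fix S assume S: "S \<in> ?I"
      have "1 \<le> of_bool (u \<in> S) + of_bool (u \<notin> S \<and> (\<forall>w\<in>S. \<not> adj u w))
                 + (\<Sum>w\<in>nb u. of_bool (w \<in> S) :: real)"
      proof (cases "u \<in> S \<or> (\<forall>w\<in>S. \<not> adj u w)")
        case True
        have "0 \<le> (\<Sum>w\<in>nb u. of_bool (w \<in> S) :: real)" by (rule sum_nonneg) auto
        then show ?thesis using True by auto
      next
        case False
        then obtain w where w: "w \<in> S" "adj u w" by auto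
        then have "w \<in> nb u" using S unfolding nb_def indep_sets_def by auto
        then have "of_bool (w \<in> S) \<le> (\<Sum>w\<in>nb u. of_bool (w \<in> S) :: real)"
          by (intro member_le_sum) (auto simp: finnb)
        then show ?thesis using w by auto
      qed
      then show "l ^ card S \<le> (of_bool (u \<in> S) + of_bool (u \<notin> S \<and> (\<forall>w\<in>S. \<not> adj u w))
                 + (\<Sum>w\<in>nb u. of_bool (w \<in> S))) * l ^ card S"
        using mult_right_mono[of 1 _ "l ^ card S"] l by fastforce
    qed
    also have "\<dots> = O1 u + F u + (\<Sum>S\<in>?I. \<Sum>w\<in>nb u. of_bool (w \<in> S) * l ^ card S)"
      unfolding O1_def F_def by (simp add: algebra_simps sum.distrib sum_distrib_left)
    also have "(\<Sum>S\<in>?I. \<Sum>w\<in>nb u. of_bool (w \<in> S) * l ^ card S) = (\<Sum>w\<in>nb u. O1 w)"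
      unfolding O1_def by (rule sum.swap)
    finally show ?thesis .
  qed
  \<comment> \<open>Multiplying \<open>cover\<close> by \<open>l\<close> turns
    \<open>l * F u\<close> into \<open>O1 u\<close>, while each neighbour is occupied with weight at
    most \<open>l * Z\<close>.\<close>
  have step: "l * Z * (1 - l * real (card (nb u))) \<le> (1 + l) * O1 u" if u: "u \<in> X" for u
  proof -
    have "(\<Sum>w\<in>nb u. O1 w) \<le> (\<Sum>w\<in>nb u. l * Z)"
      by (rule sum_mono) (use OF1 FZ l in \<open>auto simp: nb_def intro: mult_left_mono\<close>)
    then have "Z \<le> O1 u + F u + real (card (nb u)) * (l * Z)"
      using cover[of u] by simp
    then have "l * Z \<le> l * (O1 u + F u + real (card (nb u)) * (l * Z))"
      using l by (rule mult_left_mono)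
    then show ?thesis using OF1[OF u] by (simp add: algebra_simps)
  qed
  have edges: "(\<Sum>u\<in>X. real (card (nb u))) = real (card {(x, y). x \<in> X \<and> y \<in> X \<and> adj x y})"
  proof -
    have "{(x, y). x \<in> X \<and> y \<in> X \<and> adj x y} = Sigma X nb"
      unfolding nb_def by auto
    then show ?thesis using fin finnb by (simp add: card_SigmaI)
  qed
  have size: "(\<Sum>u\<in>X. O1 u) = (\<Sum>S\<in>?I. l ^ card S * real (card S))"
  proof -
    have "(\<Sum>u\<in>X. O1 u) = (\<Sum>S\<in>?I. \<Sum>u\<in>X. of_bool (u \<in> S) * l ^ card S)"
      unfolding O1_def by (rule sum.swap)
    also have "\<dots> = (\<Sum>S\<in>?I. l ^ card S * real (card S))"
    proof (rule sum.cong)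
      fix S assume "S \<in> ?I"
      then have "X \<inter> S = S" unfolding indep_sets_def by auto
      then show "(\<Sum>u\<in>X. of_bool (u \<in> S) * l ^ card S) = l ^ card S * real (card S)"
        using fin by (simp flip: sum_distrib_right)
    qed auto
    finally show ?thesis .
  qed
  have "(\<Sum>u\<in>X. l * Z * (1 - l * real (card (nb u)))) \<le> (\<Sum>u\<in>X. (1 + l) * O1 u)"
    by (rule sum_mono) (rule step)
  moreover have "(\<Sum>u\<in>X. l * Z * (1 - l * real (card (nb u))))
     = l * Z * (real (card X) - l * (\<Sum>u\<in>X. real (card (nb u))))"
    by (simp add: algebra_simps sum_subtractf sum_distrib_left)
  ultimately show ?thesis unfolding edges size[symmetric] Z_def[symmetric]
    by (simp add: sum_distrib_left)
qed

text \<open>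
  The independent sets with a prescribed trace \<open>H\<close> outside the closed neighbourhood of \<open>v\<close> are
  \<open>insert v H\<close> and the unions of \<open>H\<close> with the independent subsets of the neighbours of \<open>v\<close>
  that \<open>H\<close> leaves free.
\<close>

lemma hard_core_local:
  fixes l m B :: real
  assumes fin: "finite X" and irr: "\<And>x. \<not> adj x x" and sym: "\<And>x y. adj x y \<Longrightarrow> adj y x"
    and l: "0 \<le> l" and v: "v \<in> X" and N_def: "N = {u \<in> X. adj v u}"
    and loc: "\<And>Y. Y \<subseteq> N \<Longrightarrow> B * (l + (\<Sum>S\<in>indep_sets adj Y. l ^ card S))
       \<le> m * l + (\<Sum>S\<in>indep_sets adj Y. l ^ card S * real (card S))"
  shows "B * (\<Sum>S\<in>indep_sets adj X. l ^ card S)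
     \<le> (\<Sum>S\<in>indep_sets adj X. l ^ card S * (m * of_bool (v \<in> S) + real (card (S \<inter> N))))"
proof -
  let ?I = "indep_sets adj X"
  define g where "g S = S - insert v N" for S
  \<comment> \<open>The term of \<open>S\<close> on the right-hand side minus its term on the left;
    the goal is that these sum to a nonnegative number.\<close>
  define h where "h S = l ^ card S * (m * of_bool (v \<in> S) + real (card (S \<inter> N)) - B)" for S
  have fI: "finite ?I" using fin by (rule finite_indep_sets)
  have finN: "finite N" using fin N_def by auto
  have vN: "v \<notin> N" using irr N_def by auto
  \<comment> \<open>On the fibre over \<open>H\<close> the sum of \<open>h\<close> is
    \<open>l ^ card H\<close> times the gap in \<open>loc\<close>, taken for the neighbours of
    \<open>v\<close> that \<open>H\<close> does not block.\<close>
  have fibre: "0 \<le> (\<Sum>S\<in>{S \<in> ?I. g S = H}. h S)" if "H \<in> g ` ?I" for H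
  proof -
    have H: "H \<subseteq> X" "H \<inter> insert v N = {}" "\<And>x y. x \<in> H \<Longrightarrow> y \<in> H \<Longrightarrow> \<not> adj x y"
      using that unfolding g_def indep_sets_def by auto
    have finH: "finite H" using H fin finite_subset by auto
    define Y where "Y = {u \<in> N. \<forall>x\<in>H. \<not> adj u x}"
    let ?J = "indep_sets adj Y"
    have YN: "Y \<subseteq> N" unfolding Y_def by auto
    have finY: "finite Y" using YN finN finite_subset by auto
    have finJ: "finite ?J" using finY by (rule finite_indep_sets)
    have JD: "T \<subseteq> N" "finite T" "H \<inter> T = {}" "v \<notin> T" if "T \<in> ?J" for T
      using that YN finY H vN finite_subset unfolding indep_sets_def by auto
    have vH: "\<not> adj v x" "\<not> adj x v" if "x \<in> H" for x
      using that H sym unfolding N_def by auto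
    have eq: "{S \<in> ?I. g S = H} = insert (insert v H) ((\<union>) H ` ?J)"
    proof (intro equalityI subsetI)
      fix S assume S: "S \<in> {S \<in> ?I. g S = H}"
      show "S \<in> insert (insert v H) ((\<union>) H ` ?J)"
      proof (cases "v \<in> S")
        case True
        then have "S = insert v H" using S unfolding g_def indep_sets_def N_def by auto
        then show ?thesis by simp
      next
        case False
        have "S = H \<union> (S \<inter> N)" using S False unfolding g_def by auto
        moreover have "S \<inter> N \<in> ?J" using S unfolding g_def indep_sets_def Y_def by auto
        ultimately show ?thesis by auto
      qed
    next
      fix S assume S: "S \<in> insert (insert v H) ((\<union>) H ` ?J)"
      show "S \<in> {S \<in> ?I. g S = H}"
      proof (cases "S = insert v H")
        case True
        have "S \<in> ?I" using True H v vH irr unfolding indep_sets_def by auto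
        moreover have "g S = H" using True H unfolding g_def by auto
        ultimately show ?thesis by simp
      next
        case False
        then obtain T where T: "T \<in> ?J" "S = H \<union> T" using S by auto
        have "g S = H" using T JD[OF T(1)] H unfolding g_def by auto
        moreover have "S \<in> ?I"
        proof -
          have "\<not> adj x y" if "x \<in> T" "y \<in> T" for x y
            using T(1) that unfolding indep_sets_def by auto
          moreover have "\<not> adj x y" "\<not> adj y x" if "x \<in> T" "y \<in> H" for x y
            using T(1) that sym unfolding indep_sets_def Y_def by auto
          moreover have "T \<subseteq> X" using JD[OF T(1)] N_def by auto
          ultimately show ?thesis using H T(2) unfolding indep_sets_def by auto
        qed
        ultimately show ?thesis by simp
      qed
    qed
    have inj: "inj_on ((\<union>) H) ?J"
      using JD by (intro inj_onI) blast
    have notin: "insert v H \<notin> (\<union>) H ` ?J" using H JD by auto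
    have "(\<Sum>S\<in>{S \<in> ?I. g S = H}. h S) = h (insert v H) + (\<Sum>T\<in>?J. h (H \<union> T))"
      unfolding eq using finJ notin by (simp add: sum.reindex[OF inj])
    moreover have "h (insert v H) = l ^ card H * (l * (m - B))"
      using H finH vN by (auto simp: h_def Int_commute)
    moreover have "(\<Sum>T\<in>?J. h (H \<union> T)) = (\<Sum>T\<in>?J. l ^ card H * (l ^ card T * real (card T) - B * l ^ card T))"
    proof (rule sum.cong)
      fix T assume T: "T \<in> ?J"
      have "(H \<union> T) \<inter> N = T" using JD[OF T] H by auto
      moreover have "card (H \<union> T) = card H + card T" using JD[OF T] finH by (simp add: card_Un_disjoint)
      moreover have "v \<notin> H \<union> T" using JD[OF T] H by auto
      ultimately show "h (H \<union> T) = l ^ card H * (l ^ card T * real (card T) - B * l ^ card T)"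
        by (simp add: h_def power_add algebra_simps)
    qed simp
    ultimately have "(\<Sum>S\<in>{S \<in> ?I. g S = H}. h S) = l ^ card H *
       (m * l + (\<Sum>S\<in>?J. l ^ card S * real (card S)) - B * (l + (\<Sum>S\<in>?J. l ^ card S)))"
      by (simp add: algebra_simps sum_subtractf sum_distrib_left)
    then show ?thesis using loc[OF YN] l by simp
  qed
  have "(\<Sum>S\<in>?I. h S) = (\<Sum>H\<in>g ` ?I. \<Sum>S\<in>{S \<in> ?I. g S = H}. h S)"
    using fI by (intro sum.group[symmetric]) auto
  also have "\<dots> \<ge> 0" by (rule sum_nonneg) (rule fibre)
  finally show ?thesis
    by (simp add: h_def algebra_simps sum_subtractf sum.distrib sum_distrib_left)
qed

text \<open>Sum the local inequality over all \<open>v\<close> and exchange the sums. A set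
  \<open>S\<close> then collects \<open>m * card S\<close> from its own vertices and, by double
  counting adjacent pairs, at most \<open>m * card S\<close> from its traces on neighbourhoods. Some
  set must reach the weighted average.\<close>

lemma indep_set_of_hard_core_local:
  fixes l B :: real and m :: nat
  assumes fin: "finite X" and irr: "\<And>x. \<not> adj x x" and sym: "\<And>x y. adj x y \<Longrightarrow> adj y x"
    and l: "0 \<le> l" and m: "0 < m"
    and deg: "\<And>v. v \<in> X \<Longrightarrow> card {u \<in> X. adj v u} \<le> m"
    and loc: "\<And>v Y. v \<in> X \<Longrightarrow> Y \<subseteq> {u \<in> X. adj v u} \<Longrightarrow>
       B * (l + (\<Sum>S\<in>indep_sets adj Y. l ^ card S))
       \<le> real m * l + (\<Sum>S\<in>indep_sets adj Y. l ^ card S * real (card S))"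
  shows "\<exists>S\<in>indep_sets adj X. real (card X) * B \<le> 2 * real m * real (card S)"
proof (rule ccontr)
  let ?I = "indep_sets adj X"
  assume neg: "\<not> ?thesis"
  have fI: "finite ?I" using fin by (rule finite_indep_sets)
  have "real (card X) * (B * (\<Sum>S\<in>?I. l ^ card S)) = (\<Sum>v\<in>X. B * (\<Sum>S\<in>?I. l ^ card S))"
    by simp
  also have "\<dots> \<le> (\<Sum>v\<in>X. \<Sum>S\<in>?I. l ^ card S *
       (real m * of_bool (v \<in> S) + real (card (S \<inter> {u \<in> X. adj v u}))))"
    by (intro sum_mono hard_core_local) (use assms in auto)
  also have "\<dots> = (\<Sum>S\<in>?I. \<Sum>v\<in>X. l ^ card S *
       (real m * of_bool (v \<in> S) + real (card (S \<inter> {u \<in> X. adj v u}))))"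
    by (rule sum.swap)
  also have "\<dots> \<le> (\<Sum>S\<in>?I. l ^ card S * (2 * real m * real (card S)))"
  proof (rule sum_mono)
    fix S assume S: "S \<in> ?I"
    then have SX: "S \<subseteq> X" "finite S" using fin finite_subset unfolding indep_sets_def by auto
    have 1: "(\<Sum>v\<in>X. real m * of_bool (v \<in> S)) = real m * real (card S)"
      using SX fin by (simp add: Int_absorb1 flip: sum_distrib_left)
    have "(\<Sum>v\<in>X. card (S \<inter> {u \<in> X. adj v u})) = (\<Sum>v\<in>X. card {u \<in> S. adj v u})"
      using SX by (intro sum.cong arg_cong[where f = card]) auto
    also have "\<dots> = (\<Sum>u\<in>S. card {v \<in> X. adj v u})"
      by (rule sum_multicount_gen) (use fin SX in auto)
    also have "\<dots> \<le> (\<Sum>u\<in>S. m)"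
    proof (rule sum_mono)
      fix u assume "u \<in> S"
      moreover have "{v \<in> X. adj v u} = {v \<in> X. adj u v}" using sym by auto
      ultimately show "card {v \<in> X. adj v u} \<le> m" using deg SX by auto
    qed
    also have "\<dots> = m * card S" by simp
    finally have "real (\<Sum>v\<in>X. card (S \<inter> {u \<in> X. adj v u})) \<le> real (m * card S)"
      by (simp only: of_nat_le_iff)
    then have 2: "(\<Sum>v\<in>X. real (card (S \<inter> {u \<in> X. adj v u}))) \<le> real m * real (card S)" by simp
    have "(\<Sum>v\<in>X. real m * of_bool (v \<in> S) + real (card (S \<inter> {u \<in> X. adj v u})))
        \<le> 2 * real m * real (card S)"
      using 1 2 unfolding sum.distrib by linarith
    then show "(\<Sum>v\<in>X. l ^ card S * (real m * of_bool (v \<in> S) + real (card (S \<inter> {u \<in> X. adj v u}))))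
        \<le> l ^ card S * (2 * real m * real (card S))"
      unfolding sum_distrib_left[symmetric] using l by (intro mult_left_mono) auto
  qed
  also have "\<dots> < (\<Sum>S\<in>?I. l ^ card S * (real (card X) * B))"
  proof (rule sum_strict_mono_ex1)
    show "\<forall>S\<in>?I. l ^ card S * (2 * real m * real (card S)) \<le> l ^ card S * (real (card X) * B)"
      using neg l by (auto intro!: mult_left_mono simp: not_le)
    \<comment> \<open>The empty set has weight 1 whatever \<open>l\<close> is, so strictness
      survives even for \<open>l = 0\<close>.\<close>
    show "\<exists>S\<in>?I. l ^ card S * (2 * real m * real (card S)) < l ^ card S * (real (card X) * B)"
      using neg empty_in_indep_sets[of adj X] by (intro bexI[of _ "{}"]) auto
  qed fact
  also have "\<dots> = real (card X) * (B * (\<Sum>S\<in>?I. l ^ card S))"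
    by (simp add: sum_distrib_left algebra_simps)
  finally show False by simp
qed

text \<open>The Gilbert argument: the closed neighbourhoods of a maximal independent set cover the
  graph, and each has at most \<open>m\<close> vertices.\<close>

lemma maximal_indep_set:
  fixes m :: nat
  assumes fin: "finite X" and irr: "\<And>x. \<not> adj x x" and sym: "\<And>x y. adj x y \<Longrightarrow> adj y x"
    and deg: "\<And>v. v \<in> X \<Longrightarrow> card {u \<in> X. adj v u} < m"
  shows "\<exists>S\<in>indep_sets adj X. card X \<le> m * card S"
proof -
  let ?I = "indep_sets adj X"
  obtain S where S: "S \<in> ?I" and max: "\<And>T. T \<in> ?I \<Longrightarrow> S \<subseteq> T \<Longrightarrow> S = T"
    using finite_has_maximal[OF finite_indep_sets[OF fin, of adj]] empty_in_indep_sets[of adj X] by auto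
  have SX: "S \<subseteq> X" "finite S" using S fin finite_subset unfolding indep_sets_def by auto
  have "X \<subseteq> (\<Union>v\<in>S. insert v {u \<in> X. adj v u})"
  proof
    fix x assume x: "x \<in> X"
    show "x \<in> (\<Union>v\<in>S. insert v {u \<in> X. adj v u})"
    proof (rule ccontr)
      assume c: "\<not> ?thesis"
      then have "insert x S \<in> ?I" using S x irr sym unfolding indep_sets_def by auto
      then have "S = insert x S" using max by blast
      then show False using c by auto
    qed
  qed
  then have "card X \<le> card (\<Union>v\<in>S. insert v {u \<in> X. adj v u})"
    using fin SX by (intro card_mono) auto
  also have "\<dots> \<le> (\<Sum>v\<in>S. card (insert v {u \<in> X. adj v u}))"
    using SX by (intro card_UN_le)
  also have "\<dots> \<le> (\<Sum>v\<in>S. m)"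
  proof (rule sum_mono)
    fix v assume "v \<in> S"
    then have "card {u \<in> X. adj v u} < m" using deg SX by auto
    then show "card (insert v {u \<in> X. adj v u}) \<le> m"
      using fin irr by simp
  qed
  finally show ?thesis using S by (auto simp: mult.commute)
qed

section \<open>Numerical estimates for the fugacity argument\<close>

lemma exp_ge_linear:
  fixes t :: real
  assumes "3 \<le> t"
  shows "19 * (t - 2) \<le> exp t"
proof -
  \<comment> \<open>The 32nd power is precise enough: the cube of 2.67 just exceeds 19.\<close>
  have "2.67 \<le> (1 + 1 / real 32) ^ 32" by (simp add: power_divide)
  also have "\<dots> \<le> exp 1" by (rule exp_ge_one_plus_x_over_n_power_n) auto
  finally have "2.67 ^ 3 \<le> exp (1::real) ^ 3" by (rule power_mono) simp
  also have "\<dots> = exp 3" by (simp flip: exp_of_nat_mult)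
  finally have e3: "19 \<le> exp (3::real)" by (simp add: power3_eq_cube)
  \<comment> \<open>The tangent of \<open>exp\<close> at 3 is
    \<open>exp 3 * (t - 2)\<close>.\<close>
  have "19 * (t - 2) \<le> exp 3 * (1 + (t - 3))"
    using mult_mono[OF e3 order_refl, of "t - 2"] assms by simp
  also have "\<dots> \<le> exp 3 * exp (t - 3)" by (intro mult_left_mono exp_ge_add_one_self) auto
  finally show ?thesis by (simp flip: exp_add)
qed

text \<open>Equivalent to \<open>1/2 \<le> exp (-2/3)\<close>, and the 32nd power of
  \<open>1 - 1/48\<close> already lies between the two.\<close>

lemma ln_2_ge: "2/3 \<le> ln (2::real)"
proof -
  have "1/2 \<le> (1 + (-2/3) / real 32) ^ 32" by (simp add: power_divide)
  also have "\<dots> \<le> exp (-2/3)" by (rule exp_ge_one_plus_x_over_n_power_n) auto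
  finally have "exp (2/3) \<le> (2::real)" by (simp add: exp_minus field_simps)
  then show ?thesis using ln_ge_iff[of 2 "2/3"] by simp
qed

text \<open>The trade-off at one vertex: \<open>y\<close> stands for \<open>l * card Y\<close>,
  \<open>Z\<close> for the partition function of \<open>Y\<close>, \<open>N1\<close> for its
  unnormalised mean size, and \<open>exp L / 8\<close> for \<open>m * l\<close>. For small
  \<open>y\<close> the bound on \<open>Z\<close> lets \<open>exp L / 8\<close> alone suffice; for
  large \<open>y\<close> the mean size alone does.\<close>

lemma hard_core_numeric:
  fixes L l y Z N1 :: real
  assumes L: "20/3 \<le> L" and l: "0 \<le> l" "l \<le> 31/100"
    and Z: "1 \<le> Z" "Z \<le> exp y"
    and N1: "Z * (y - 3/32) \<le> (1 + l) * N1" "0 \<le> N1"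
  shows "3/10 * L * (l + Z) \<le> exp L / 8 + N1"
proof (cases "y \<le> 55/100 * L")
  case True
  define a where "a = exp (55/100 * L)"
  define b where "b = exp (45/100 * L)"
  have ab: "exp L = a * b" unfolding a_def b_def by (simp flip: exp_add)
  have Za: "Z \<le> a" using Z True unfolding a_def by (meson exp_le_cancel_iff order_trans)
  have "19 * (55/100 * L - 2) \<le> a" unfolding a_def by (rule exp_ge_linear) (use L in linarith)
  moreover have "11/3 \<le> 55/100 * L" using L by simp
  ultimately have a10: "19 \<le> a" by (simp add: field_simps)
  \<comment> \<open>The hypothesis \<open>20/3 \<le> L\<close> is what brings
    \<open>45/100 * L\<close> up to 3, where \<open>exp_ge_linear\<close> starts.\<close>
  have b: "19 * (45/100 * L - 2) \<le> b" unfolding b_def by (rule exp_ge_linear) (use L in linarith)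
  have b': "2.6 * L \<le> b" using b L by (simp add: field_simps)
  \<comment> \<open>Since \<open>l \<le> 31/100\<close> and \<open>19 \<le> a\<close>, the summand
    \<open>l\<close> is at most \<open>31/1900 * a\<close>.\<close>
  have "3/10 * L * (l + Z) \<le> 3/10 * L * (a * (1 + 31/1900))"
    using l Za a10 L by (intro mult_left_mono) auto
  also have "\<dots> \<le> a * (2.6 * L) / 8" using L a10 by (simp add: field_simps)
  also have "\<dots> \<le> a * b / 8" using b' a10 by auto
  finally show ?thesis using N1 ab by linarith
next
  case False
  have "Z * (55/100 * L - 3/32) \<le> Z * (y - 3/32)"
    using False Z by (intro mult_left_mono) auto
  also have "\<dots> \<le> (1 + l) * N1" by (rule N1)
  also have "\<dots> \<le> 131/100 * N1" using l N1 by (intro mult_right_mono) auto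
  finally have 1: "Z * (55/100 * L - 3/32) \<le> 131/100 * N1" .
  \<comment> \<open>Passing from \<open>l + Z\<close> to \<open>Z\<close> and from
    \<open>1 + l\<close> to a constant costs a factor 131/100 each. As 3/10 times its square is
    below 0.515, the gap to 55/100 absorbs 3/32 when \<open>20/3 \<le> L\<close>.\<close>
  have "3/10 * L * (l + Z) \<le> 3/10 * L * (131/100 * Z)"
    using l Z L by (intro mult_left_mono) auto
  then have "131/100 * (3/10 * L * (l + Z)) \<le> Z * (131/100 * (3/10 * (131/100)) * L)" by simp
  also have "\<dots> \<le> Z * (55/100 * L - 3/32)" using Z L by (intro mult_left_mono) auto
  finally have "3/10 * L * (l + Z) \<le> N1" using 1 by linarith
  then show ?thesis using exp_gt_zero[of L] by linarith
qed

text \<open>A bound of Ajtai-Komlos-Szemeredi type. The pairs counted in \<open>sparse\<close> are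
  ordered, so each neighbourhood spans at most \<open>3 * E\<close> edges.\<close>

theorem locally_sparse_indep_set:
  fixes E :: real and m :: nat
  assumes fin: "finite X" and irr: "\<And>x. \<not> adj x x" and sym: "\<And>x y. adj x y \<Longrightarrow> adj y x"
    and deg: "\<And>v. v \<in> X \<Longrightarrow> card {u \<in> X. adj v u} < m"
    and E: "1/6 \<le> E"
    and sparse: "\<And>v. v \<in> X \<Longrightarrow>
       real (card {(x, y). x \<in> X \<and> y \<in> X \<and> adj v x \<and> adj v y \<and> adj x y}) \<le> 6 * E"
    and m: "0 < m"
  shows "\<exists>S\<in>indep_sets adj X.
     real (card X) / real m * ((log 2 (real m) - log 2 (sqrt E)) / 10) \<le> real (card S)"
proof (cases "log 2 (real m) - log 2 (sqrt E) \<le> 10")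
  \<comment> \<open>Here the claimed size is at most \<open>card X / m\<close>, so the Gilbert bound
    suffices.\<close>
  case True
  obtain S where S: "S \<in> indep_sets adj X" "card X \<le> m * card S"
    using maximal_indep_set[OF fin irr sym deg] by blast
  have "real (card X) / real m * ((log 2 (real m) - log 2 (sqrt E)) / 10) \<le> real (card X) / real m * 1"
    using True by (intro mult_left_mono) auto
  also have "\<dots> \<le> real (card S)"
  proof -
    have "real (card X) \<le> real (m * card S)" using S by (simp only: of_nat_le_iff)
    then show ?thesis using m by (simp add: field_simps)
  qed
  finally show ?thesis using S by auto
next
  case False
  \<comment> \<open>The factor 8 gives \<open>l * l * E = 1/64\<close>, so conflicts cost only 6/64
    = 3/32 in the bound on the mean size.\<close>
  define l where "l = 1 / (8 * sqrt E)"
  define L where "L = ln (real m / sqrt E)"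
  \<comment> \<open>Twice the factor wanted, because the averaging lemma loses a factor 2.\<close>
  define B where "B = (log 2 (real m) - log 2 (sqrt E)) / 5"
  have sE: "0 < sqrt E" using E by simp
  have logL: "log 2 (real m) - log 2 (sqrt E) = L / ln 2"
    using m sE by (simp add: L_def log_def ln_div diff_divide_distrib)
  have ln2: "2/3 \<le> ln (2::real)" by (rule ln_2_ge)
  have L10: "10 * ln 2 < L" using False ln2 unfolding logL by (simp add: field_simps)
  then have L: "20/3 \<le> L" using ln2 by linarith
  have BL: "B \<le> 3/10 * L"
  proof -
    have "L / ln 2 \<le> L / (2/3)" using L ln2 by (intro divide_left_mono) auto
    then show ?thesis unfolding B_def logL by (simp add: mult.commute)
  qed
  have l0: "0 \<le> l" using sE unfolding l_def by simp
  have lE: "l * l * E = 1/64" using sE E unfolding l_def by (simp add: field_simps)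
  \<comment> \<open>The number 100/248 is chosen because 1 / (8 * 100/248) = 31/100, and its square
    is just below 1/6.\<close>
  have "(100/248)\<^sup>2 \<le> E" using E by (simp add: power2_eq_square)
  then have "100/248 \<le> sqrt E" by (rule real_le_rsqrt)
  then have l31: "l \<le> 31/100" using sE unfolding l_def by (simp add: field_simps)
  have ml: "real m * l = exp L / 8" using m sE unfolding l_def L_def by simp
  have "\<exists>S\<in>indep_sets adj X. real (card X) * B \<le> 2 * real m * real (card S)"
  proof (rule indep_set_of_hard_core_local[where l = l])
    fix v Y assume v: "v \<in> X" and Y: "Y \<subseteq> {u \<in> X. adj v u}"
    let ?I = "indep_sets adj Y"
    define Z where "Z = (\<Sum>S\<in>?I. l ^ card S)"
    define N1 where "N1 = (\<Sum>S\<in>?I. l ^ card S * real (card S))"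
    have finY: "finite Y" by (rule finite_subset[OF Y]) (use fin in auto)
    have Z1: "1 \<le> Z" unfolding Z_def using finY l0 by (rule hard_core_partition_ge_1)
    have "Z \<le> (1 + l) ^ card Y" unfolding Z_def using finY l0 by (rule hard_core_partition_le)
    also have "\<dots> \<le> exp l ^ card Y" using l0 by (intro power_mono exp_ge_add_one_self) auto
    also have "\<dots> = exp (l * real (card Y))" by (simp add: mult.commute flip: exp_of_nat_mult)
    finally have Z2: "Z \<le> exp (l * real (card Y))" .
    have "card {(x, y). x \<in> Y \<and> y \<in> Y \<and> adj x y}
       \<le> card {(x, y). x \<in> X \<and> y \<in> X \<and> adj v x \<and> adj v y \<and> adj x y}"
    proof (rule card_mono)
      show "finite {(x, y). x \<in> X \<and> y \<in> X \<and> adj v x \<and> adj v y \<and> adj x y}"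
        by (rule finite_subset[of _ "X \<times> X"]) (use fin in auto)
    qed (use Y in auto)
    then have M: "real (card {(x, y). x \<in> Y \<and> y \<in> Y \<and> adj x y}) \<le> 6 * E"
      using sparse[OF v] by linarith
    have "Z * (l * real (card Y) - 3/32) = l * Z * (real (card Y)) - Z * (6 * (l * l * E))"
      unfolding lE by (simp add: algebra_simps)
    also have "\<dots> = l * Z * (real (card Y) - l * (6 * E))"
      by (simp add: algebra_simps)
    also have "\<dots> \<le> l * Z * (real (card Y) - l * real (card {(x, y). x \<in> Y \<and> y \<in> Y \<and> adj x y}))"
      using M l0 Z1 by (intro mult_left_mono diff_left_mono) auto
    also have "\<dots> \<le> (1 + l) * N1"
      unfolding Z_def N1_def by (rule hard_core_mean_size_ge) (use finY irr sym l0 in auto)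
    finally have N1: "Z * (l * real (card Y) - 3/32) \<le> (1 + l) * N1" .
    have "0 \<le> N1" unfolding N1_def using l0 by (intro sum_nonneg) auto
    then have "3/10 * L * (l + Z) \<le> exp L / 8 + N1"
      by (intro hard_core_numeric[OF L l0 l31 Z1 Z2 N1])
    moreover have "B * (l + Z) \<le> 3/10 * L * (l + Z)"
      using BL l0 Z1 by (intro mult_right_mono) auto
    ultimately show "B * (l + (\<Sum>S\<in>?I. l ^ card S))
       \<le> real m * l + (\<Sum>S\<in>?I. l ^ card S * real (card S))"
      unfolding ml Z_def[symmetric] N1_def[symmetric] by linarith
  qed (use assms l0 less_imp_le in blast)+
  then show ?thesis using m by (auto simp: B_def field_simps)
qed

subsection \<open>Words and pairs of words at prescribed distances\<close>

lemma words_0: "words q 0 = {[]}"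
  unfolding words_def by auto

lemma words_Suc: "words q (Suc n) = (\<lambda>(a, xs). a # xs) ` ({..<q} \<times> words q n)"
proof -
  have "x \<in> (\<lambda>(a, xs). a # xs) ` ({..<q} \<times> words q n)" if "x \<in> words q (Suc n)" for x
    using that unfolding words_def by (cases x) auto
  then show ?thesis unfolding words_def by auto
qed

lemma finite_words: "finite (words q n)"
  by (induction n) (simp_all add: words_0 words_Suc)

lemma card_words: "card (words q n) = q ^ n"
proof (induction n)
  case (Suc n)
  have "card (words q (Suc n)) = card ({..<q} \<times> words q n)"
    unfolding words_Suc by (rule card_image) (auto simp: inj_on_def)
  then show ?case using Suc by (simp add: card_cartesian_product)
qed (simp add: words_0)

lemma length_words: "x \<in> words q n \<Longrightarrow> length x = n"
  unfolding words_def by auto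

lemma hamming_dist_Nil: "hamming_dist [] y = 0"
  unfolding hamming_dist_def by simp

lemma hamming_dist_Cons: "hamming_dist (x # xs) (y # ys) = of_bool (x \<noteq> y) + hamming_dist xs ys"
proof -
  have "{i. i < length (x # xs) \<and> (x # xs) ! i \<noteq> (y # ys) ! i}
      = (if x \<noteq> y then {0} else {}) \<union> Suc ` {i. i < length xs \<and> xs ! i \<noteq> ys ! i}" (is "?L = ?R")
  proof (intro set_eqI)
    fix i show "i \<in> ?L \<longleftrightarrow> i \<in> ?R" by (cases i) auto
  qed
  moreover have "card ?R = of_bool (x \<noteq> y) + card (Suc ` {i. i < length xs \<and> xs ! i \<noteq> ys ! i})"
    by (subst card_Un_disjoint) auto
  ultimately show ?thesis unfolding hamming_dist_def by (simp add: card_image)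
qed

lemma hamming_dist_commute: "length x = length y \<Longrightarrow> hamming_dist x y = hamming_dist y x"
  unfolding hamming_dist_def by (simp add: eq_commute)

lemma hamming_dist_eq_0:
  "length x = length y \<Longrightarrow> hamming_dist x y = 0 \<longleftrightarrow> x = y"
  unfolding hamming_dist_def by (auto intro: nth_equalityI)

lemma hamming_dist_self: "hamming_dist x x = 0"
  unfolding hamming_dist_def by simp

lemma hamming_dist_triangle:
  assumes "length x = length y" "length y = length z"
  shows "hamming_dist x z \<le> hamming_dist x y + hamming_dist y z"
  using assms by (induction x y z rule: list_induct3) (auto simp: hamming_dist_Nil hamming_dist_Cons)

text \<open>The first letter either agrees with that of \<open>v\<close> or differs in one of
  \<open>q - 1\<close> ways, which reproduces Pascal's rule.\<close>

lemma card_sphere: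
  assumes "v \<in> words q n"
  shows "card {y \<in> words q n. hamming_dist v y = w} = (n choose w) * (q - 1) ^ w"
  using assms
proof (induction n arbitrary: v w)
  case 0
  then show ?case by (cases w) (auto simp: words_0 hamming_dist_Nil Collect_conv_if)
next
  case (Suc n)
  then obtain a vs where v: "v = a # vs" "a < q" "vs \<in> words q n"
    by (auto simp: words_Suc)
  let ?f = "\<lambda>(b, xs). b # xs :: nat list"
  let ?S = "\<lambda>w. {y \<in> words q n. hamming_dist vs y = w}"
  have inj: "inj_on ?f X" for X by (auto simp: inj_on_def)
  have fin: "finite (?S w)" for w using finite_words by auto
  have c: "card ({..<q} - {a}) = q - 1" using v by simp
  show ?case
  proof (cases w)
    case 0
    have "{y \<in> words q (Suc n). hamming_dist v y = w} = ?f ` ({a} \<times> ?S 0)"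
      unfolding words_Suc v 0 using v by (auto simp: hamming_dist_Cons)
    then show ?thesis using Suc.IH[OF v(3), of 0] 0 by (simp add: card_image[OF inj] card_cartesian_product)
  next
    case (Suc w')
    have "{y \<in> words q (Suc n). hamming_dist v y = w}
        = ?f ` {p \<in> {..<q} \<times> words q n. hamming_dist v (?f p) = w}"
      unfolding words_Suc by auto
    also have "{p \<in> {..<q} \<times> words q n. hamming_dist v (?f p) = w}
        = {a} \<times> ?S w \<union> ({..<q} - {a}) \<times> ?S w'"
      using v Suc by (auto simp: hamming_dist_Cons of_bool_def split: if_splits)
    finally have "card {y \<in> words q (Suc n). hamming_dist v y = w}
       = card ({a} \<times> ?S w \<union> ({..<q} - {a}) \<times> ?S w')"
      by (simp add: card_image[OF inj])
    also have "\<dots> = card (?S w) + (q - 1) * card (?S w')"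
      using fin by (subst card_Un_disjoint) (auto simp: card_cartesian_product c)
    also have "\<dots> = (n choose w) * (q - 1) ^ w + (q - 1) * ((n choose w') * (q - 1) ^ w')"
      by (simp only: Suc.IH[OF v(3)])
    also have "\<dots> = (Suc n choose w) * (q - 1) ^ w"
      unfolding Suc binomial_Suc_Suc power_Suc add_mult_distrib by (simp only: ac_simps)
    finally show ?thesis .
  qed
qed

lemma card_ball:
  assumes "v \<in> words q n"
  shows "card {y \<in> words q n. hamming_dist v y \<le> r} = V q n r"
proof -
  let ?B = "{y \<in> words q n. hamming_dist v y \<le> r}"
  have "card ?B = (\<Sum>y\<in>?B. 1)" by simp
  also have "\<dots> = (\<Sum>w=0..r. \<Sum>y\<in>{y \<in> ?B. hamming_dist v y = w}. 1)"
    using finite_words by (intro sum.group[symmetric]) auto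
  also have "\<dots> = (\<Sum>w=0..r. card {y \<in> words q n. hamming_dist v y = w})"
    by (auto intro!: sum.cong arg_cong[where f = card])
  finally show ?thesis using card_sphere[OF assms] unfolding V_def by simp
qed

section \<open>Coordinate patterns of two words relative to a third\<close>

text \<open>
  The position of two letters \<open>b\<close> and \<open>c\<close> relative to a reference letter \<open>a\<close>. The numbers of
  coordinates of the last four kinds are \<open>j\<close>, \<open>k\<close>, \<open>w - c\<close> and \<open>i - c\<close> in the definition of \<open>e\<close>.
\<close>

datatype pos = PNone | PSame | PDiff | PFst | PSnd

lemma UNIV_pos: "UNIV = {PNone, PSame, PDiff, PFst, PSnd}"
proof -
  have "x \<in> {PNone, PSame, PDiff, PFst, PSnd}" for x by (cases x) auto
  then show ?thesis by auto
qed

lemma finite_UNIV_pos: "finite (UNIV :: pos set)"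
  by (simp add: UNIV_pos)

definition pos_of :: "'a \<Rightarrow> 'a \<Rightarrow> 'a \<Rightarrow> pos" where
  "pos_of a b c = (if b = a then (if c = a then PNone else PSnd)
     else if c = a then PFst else if b = c then PSame else PDiff)"

definition pos_word :: "'a list \<Rightarrow> 'a list \<Rightarrow> 'a list \<Rightarrow> pos list" where
  "pos_word v y z = map (\<lambda>(a, b, c). pos_of a b c) (zip v (zip y z))"

text \<open>The number of pairs of letters in the given position relative to a fixed reference
  letter, see \<open>card_pos_of\<close>.\<close>

fun pos_weight :: "nat \<Rightarrow> pos \<Rightarrow> nat" where
  "pos_weight q PNone = 1"
| "pos_weight q PDiff = (q - 1) * (q - 2)"
| "pos_weight q _ = q - 1"

lemma pos_word_Nil: "pos_word [] y z = []"
  and pos_word_Cons: "pos_word (a # v) (b # y) (c # z) = pos_of a b c # pos_word v y z"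
  unfolding pos_word_def by auto

lemma length_pos_word: "length y = length v \<Longrightarrow> length z = length v \<Longrightarrow> length (pos_word v y z) = length v"
  unfolding pos_word_def by simp

lemma card_pos_of:
  assumes "a < q"
  shows "card {(b, c). b < q \<and> c < q \<and> pos_of a b c = t} = pos_weight q t"
proof -
  let ?D = "{..<q} - {a}"
  have D: "card ?D = q - 1" "finite ?D" using assms by auto
  show ?thesis
  proof (cases t)
    case PNone
    have "{(b, c). b < q \<and> c < q \<and> pos_of a b c = t} = {(a, a)}"
      using assms PNone by (auto simp: pos_of_def split: if_splits)
    then show ?thesis using PNone by simp
  next
    case PSame
    have "{(b, c). b < q \<and> c < q \<and> pos_of a b c = t} = (\<lambda>b. (b, b)) ` ?D"
      using PSame by (auto simp: pos_of_def split: if_splits)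
    then show ?thesis using PSame D by (simp add: card_image inj_on_def)
  next
    case PFst
    have "{(b, c). b < q \<and> c < q \<and> pos_of a b c = t} = ?D \<times> {a}"
      using assms PFst by (auto simp: pos_of_def split: if_splits)
    then show ?thesis using PFst D by (simp add: card_cartesian_product)
  next
    case PSnd
    have "{(b, c). b < q \<and> c < q \<and> pos_of a b c = t} = {a} \<times> ?D"
      using assms PSnd by (auto simp: pos_of_def split: if_splits)
    then show ?thesis using PSnd D by (simp add: card_cartesian_product)
  next
    case PDiff
    have "{(b, c). b < q \<and> c < q \<and> pos_of a b c = t} = (SIGMA b:?D. ?D - {b})"
      using PDiff by (auto simp: pos_of_def split: if_splits)
    then show ?thesis using PDiff D by (simp add: card_SigmaI numeral_2_eq_2)
  qed
qed

text \<open>The coordinates can be filled independently, so the counts per letter multiply.\<close>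

lemma card_pos_word:
  assumes "v \<in> words q n" "length ts = n"
  shows "card {(y, z). y \<in> words q n \<and> z \<in> words q n \<and> pos_word v y z = ts}
       = prod_list (map (pos_weight q) ts)"
  using assms
proof (induction n arbitrary: v ts)
  case 0
  have "{(y, z). y \<in> words q 0 \<and> z \<in> words q 0 \<and> pos_word v y z = ts} = {([], [])}"
    using 0 by (auto simp: words_0 pos_word_Nil)
  then show ?case using 0 by simp
next
  case (Suc n)
  obtain a vs where v: "v = a # vs" "a < q" "vs \<in> words q n"
    using Suc.prems by (auto simp: words_Suc)
  obtain t us where ts: "ts = t # us" "length us = n"
    using Suc.prems by (cases ts) auto
  let ?f = "\<lambda>((b, c), (y, z)). (b # y, c # z) :: nat list \<times> nat list"
  let ?P = "{(b, c). b < q \<and> c < q \<and> pos_of a b c = t}"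
  let ?Q = "{(y, z). y \<in> words q n \<and> z \<in> words q n \<and> pos_word vs y z = us}"
  have "{(y, z). y \<in> words q (Suc n) \<and> z \<in> words q (Suc n) \<and> pos_word v y z = ts} = ?f ` (?P \<times> ?Q)"
    (is "?L = _")
  proof (intro equalityI subsetI)
    fix p assume "p \<in> ?L"
    then obtain b y c z where "p = (b # y, c # z)" "b < q" "c < q" "y \<in> words q n" "z \<in> words q n"
        "pos_of a b c = t" "pos_word vs y z = us"
      unfolding v ts by (auto simp: words_Suc pos_word_Cons)
    then have "p = ?f ((b, c), (y, z))" "((b, c), (y, z)) \<in> ?P \<times> ?Q" by auto
    then show "p \<in> ?f ` (?P \<times> ?Q)" by (rule image_eqI)
  next
    fix p assume "p \<in> ?f ` (?P \<times> ?Q)"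
    then show "p \<in> ?L" unfolding v ts by (auto simp: words_Suc pos_word_Cons)
  qed
  moreover have "inj_on ?f (?P \<times> ?Q)"
    by (auto simp: inj_on_def)
  ultimately have "card ?L = card ?P * card ?Q"
    by (simp only: card_image card_cartesian_product)
  also have "card ?P = pos_weight q t" by (rule card_pos_of[OF v(2)])
  also have "card ?Q = prod_list (map (pos_weight q) us)" by (rule Suc.IH[OF v(3) ts(2)])
  finally show ?case unfolding ts(1) list.map prod_list.Cons .
qed

text \<open>Group the pairs by their position word. Every arrangement of \<open>M\<close> admits the
  same number of pairs, and the number of arrangements is a multinomial coefficient.\<close>

lemma card_pos_mset:
  assumes v: "v \<in> words q n" and M: "size M = n"
  shows "real (card {(y, z). y \<in> words q n \<and> z \<in> words q n \<and> mset (pos_word v y z) = M})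
     = fact n * (\<Prod>t\<in>UNIV. real (pos_weight q t) ^ count M t / fact (count M t))"
proof -
  let ?P = "{(y, z). y \<in> words q n \<and> z \<in> words q n \<and> mset (pos_word v y z) = M}"
  let ?w = "\<Prod>t\<in>UNIV. pos_weight q t ^ count M t"
  note finU = finite_UNIV_pos
  have finP: "finite ?P"
    by (rule finite_subset[of _ "words q n \<times> words q n"]) (auto simp: finite_words)
  have "card ?P = (\<Sum>p\<in>?P. 1)" by simp
  also have "\<dots> = (\<Sum>ts\<in>permutations_of_multiset M. \<Sum>p\<in>{p \<in> ?P. (\<lambda>(y, z). pos_word v y z) p = ts}. 1)"
    using finP by (intro sum.group[symmetric]) (auto intro: permutations_of_multisetI)
  also have "\<dots> = (\<Sum>ts\<in>permutations_of_multiset M. ?w)"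
  proof (rule sum.cong)
    fix ts assume ts: "ts \<in> permutations_of_multiset M"
    then have m: "mset ts = M" by (simp add: permutations_of_multiset_def)
    then have l: "length ts = n" using M by auto
    have "{p \<in> ?P. (\<lambda>(y, z). pos_word v y z) p = ts}
        = {(y, z). y \<in> words q n \<and> z \<in> words q n \<and> pos_word v y z = ts}" using m by auto
    then have "(\<Sum>p\<in>{p \<in> ?P. (\<lambda>(y, z). pos_word v y z) p = ts}. 1) = prod_list (map (pos_weight q) ts)"
      using card_pos_word[OF v l] by simp
    also have "\<dots> = prod_mset (image_mset (pos_weight q) M)"
      using m by (metis mset_map prod_mset_prod_list)
    also have "\<dots> = ?w" unfolding image_prod_mset_multiplicity
      by (rule prod.mono_neutral_left) (auto simp: finU not_in_iff)
    finally show "(\<Sum>p\<in>{p \<in> ?P. (\<lambda>(y, z). pos_word v y z) p = ts}. 1) = ?w" .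
  qed simp
  finally have "card ?P = card (permutations_of_multiset M) * ?w" by simp
  moreover have "real (card (permutations_of_multiset M)) = fact n / (\<Prod>t\<in>UNIV. fact (count M t))"
  proof -
    have "(\<Prod>x\<in>set_mset M. fact (count M x)) = (\<Prod>t\<in>UNIV. fact (count M t) :: nat)"
      by (rule prod.mono_neutral_left) (auto simp: finU not_in_iff)
    then have "card (permutations_of_multiset M) * (\<Prod>t\<in>UNIV. fact (count M t)) = fact n"
      using card_permutations_of_multiset_aux[of M] M by simp
    from arg_cong[OF this, of real]
    have "real (card (permutations_of_multiset M)) * (\<Prod>t\<in>UNIV. fact (count M t)) = fact n"
      by simp
    moreover have "(\<Prod>t\<in>UNIV. fact (count M t) :: real) \<noteq> 0" by (simp add: finU)
    ultimately show ?thesis by (simp add: field_simps)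
  qed
  ultimately show ?thesis by (simp add: prod_dividef)
qed

lemma hamming_dist_pos_word:
  assumes "length v = length y" "length y = length z"
  shows "hamming_dist v y = count (mset (pos_word v y z)) PSame + count (mset (pos_word v y z)) PDiff
           + count (mset (pos_word v y z)) PFst"
    and "hamming_dist v z = count (mset (pos_word v y z)) PSame + count (mset (pos_word v y z)) PDiff
           + count (mset (pos_word v y z)) PSnd"
    and "hamming_dist y z = count (mset (pos_word v y z)) PDiff + count (mset (pos_word v y z)) PFst
           + count (mset (pos_word v y z)) PSnd"
  using assms
proof (induction v y z rule: list_induct3)
  case (Cons a v b y c z)
  {
    case 1
    show ?case using Cons.IH(1) by (simp add: hamming_dist_Cons pos_word_Cons pos_of_def)
  next
    case 2
    show ?case using Cons.IH(2) by (simp add: hamming_dist_Cons pos_word_Cons pos_of_def)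
  next
    case 3
    show ?case using Cons.IH(3) by (simp add: hamming_dist_Cons pos_word_Cons pos_of_def)
  }
qed (simp_all add: hamming_dist_Nil pos_word_Nil)

lemma size_pos_mset:
  fixes M :: "pos multiset"
  shows "size M = (\<Sum>t\<in>UNIV. count M t)"
proof -
  have "sum (count M) (set_mset M) = sum (count M) UNIV"
    by (rule sum.mono_neutral_left[OF finite_UNIV_pos]) (simp_all flip: not_in_iff)
  then show ?thesis by (simp add: size_multiset_overloaded_eq)
qed

text \<open>Pairs are classified by \<open>w\<close> and \<open>i\<close>, their distances from
  \<open>v\<close>, and by the numbers \<open>j\<close> and \<open>k\<close> of coordinates of kinds
  \<open>PSame\<close> and \<open>PDiff\<close>; these determine all five counts. The distance of
  the pair is \<open>w + i - 2 * j - k\<close>, so the lower limit \<open>b\<close> for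
  \<open>k\<close> says that it is at most \<open>r\<close> and that the number of
  \<open>PNone\<close> coordinates is not negative.\<close>

lemma card_close_pairs:
  assumes v: "v \<in> words q n"
  shows "real (card {(y, z). y \<in> words q n \<and> z \<in> words q n \<and> hamming_dist v y \<in> {1..r} \<and>
           hamming_dist v z \<in> {1..r} \<and> hamming_dist y z \<le> r})
    = (\<Sum>w=1..r. \<Sum>i=1..r.
      let a = min w i in
      \<Sum>j=0..a.
        let b = (w + i) - j - min (r + j) n in
        \<Sum>k=b..a - j.
          let c = j + k in
          fact n * real (q - 2) ^ k * real (q - 1) ^ (w + i - c) /
          (fact j * fact k * fact (w - c) * fact (i - c) * fact (n + c - w - i)))"
    (is "real (card ?P) = ?R")
proof -
  \<comment> \<open>The multiset of kinds that a quadruple prescribes; \<open>g\<close> reads the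
    quadruple off a pair of words.\<close>
  define M where "M = (\<lambda>(w, i, j, k).
     replicate_mset j PSame + replicate_mset k PDiff + replicate_mset (w - (j + k)) PFst
     + replicate_mset (i - (j + k)) PSnd + replicate_mset (n + (j + k) - w - i) PNone)"
  define g where "g = (\<lambda>(y, z). (hamming_dist v y, hamming_dist v z,
     count (mset (pos_word v y z)) PSame, count (mset (pos_word v y z)) PDiff))"
  define b where "b w i j = (w + i) - j - min (r + j) n" for w i j
  define T where "T = (SIGMA w:{1..r}. SIGMA i:{1..r}. SIGMA j:{0..min w i}. {b w i j..min w i - j})"
  define F where "F w i j k = fact n * real (q - 2) ^ k * real (q - 1) ^ (w + i - (j + k)) /
          (fact j * fact k * fact (w - (j + k)) * fact (i - (j + k)) * fact (n + (j + k) - w - i))"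
    for w i j k
  have finP: "finite ?P"
    by (rule finite_subset[of _ "words q n \<times> words q n"]) (auto simp: finite_words)
  have dist: "hamming_dist v y = count (mset (pos_word v y z)) PSame
         + count (mset (pos_word v y z)) PDiff + count (mset (pos_word v y z)) PFst"
      "hamming_dist v z = count (mset (pos_word v y z)) PSame
         + count (mset (pos_word v y z)) PDiff + count (mset (pos_word v y z)) PSnd"
      "hamming_dist y z = count (mset (pos_word v y z)) PDiff
         + count (mset (pos_word v y z)) PFst + count (mset (pos_word v y z)) PSnd"
      "n = count (mset (pos_word v y z)) PNone + count (mset (pos_word v y z)) PSame
         + count (mset (pos_word v y z)) PDiff + count (mset (pos_word v y z)) PFst
         + count (mset (pos_word v y z)) PSnd"
    if "y \<in> words q n" "z \<in> words q n" for y z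
  proof -
    have l: "length v = length y" "length y = length z" "length z = n"
      using v that length_words by metis+
    show "hamming_dist v y = count (mset (pos_word v y z)) PSame
         + count (mset (pos_word v y z)) PDiff + count (mset (pos_word v y z)) PFst"
      "hamming_dist v z = count (mset (pos_word v y z)) PSame
         + count (mset (pos_word v y z)) PDiff + count (mset (pos_word v y z)) PSnd"
      "hamming_dist y z = count (mset (pos_word v y z)) PDiff
         + count (mset (pos_word v y z)) PFst + count (mset (pos_word v y z)) PSnd"
      using hamming_dist_pos_word[OF l(1,2)] by auto
    have "n = size (mset (pos_word v y z))" using l by (simp add: length_pos_word)
    then show "n = count (mset (pos_word v y z)) PNone + count (mset (pos_word v y z)) PSame
         + count (mset (pos_word v y z)) PDiff + count (mset (pos_word v y z)) PFst
         + count (mset (pos_word v y z)) PSnd"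
      unfolding size_pos_mset UNIV_pos by simp
  qed
  have gT: "g p \<in> T" if "p \<in> ?P" for p
  proof -
    obtain y z where p: "p = (y, z)" by (cases p)
    have yz: "y \<in> words q n" "z \<in> words q n" using that p by auto
    show ?thesis using that dist[OF yz] unfolding p g_def T_def b_def by auto
  qed
  have cell: "real (card {p \<in> ?P. g p = (w, i, j, k)}) = F w i j k" if t: "(w, i, j, k) \<in> T" for w i j k
  proof -
    \<comment> \<open>The last two inequalities are the two arguments of the \<open>min\<close> in
      \<open>b\<close>.\<close>
    have ineq: "1 \<le> w" "w \<le> r" "1 \<le> i" "i \<le> r" "j + k \<le> w" "j + k \<le> i"
        "w + i \<le> n + (j + k)" "w + i \<le> r + j + (j + k)"
      using t unfolding T_def b_def by auto
    have cM: "count (M (w, i, j, k)) PSame = j" "count (M (w, i, j, k)) PDiff = k"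
        "count (M (w, i, j, k)) PFst = w - (j + k)" "count (M (w, i, j, k)) PSnd = i - (j + k)"
        "count (M (w, i, j, k)) PNone = n + (j + k) - w - i"
      unfolding M_def by auto
    have sM: "size (M (w, i, j, k)) = n"
      unfolding size_pos_mset UNIV_pos using ineq by (simp add: cM)
    have iff: "(hamming_dist v y \<in> {1..r} \<and> hamming_dist v z \<in> {1..r} \<and> hamming_dist y z \<le> r \<and>
        g (y, z) = (w, i, j, k)) \<longleftrightarrow> mset (pos_word v y z) = M (w, i, j, k)"
      if yz: "y \<in> words q n" "z \<in> words q n" for y z
    proof
      assume a: "hamming_dist v y \<in> {1..r} \<and> hamming_dist v z \<in> {1..r} \<and> hamming_dist y z \<le> r \<and>
        g (y, z) = (w, i, j, k)"
      then have 1: "hamming_dist v y = w" "hamming_dist v z = i"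
          "count (mset (pos_word v y z)) PSame = j" "count (mset (pos_word v y z)) PDiff = k"
        unfolding g_def by auto
      then have "count (mset (pos_word v y z)) PFst = w - (j + k)"
          "count (mset (pos_word v y z)) PSnd = i - (j + k)"
          "count (mset (pos_word v y z)) PNone = n + (j + k) - w - i"
        using dist[OF yz] by linarith+
      then have "count (mset (pos_word v y z)) t = count (M (w, i, j, k)) t" for t
        using 1 by (cases t) (simp_all only: cM)
      then show "mset (pos_word v y z) = M (w, i, j, k)" by (rule multiset_eqI)
    next
      assume "mset (pos_word v y z) = M (w, i, j, k)"
      then show "hamming_dist v y \<in> {1..r} \<and> hamming_dist v z \<in> {1..r} \<and> hamming_dist y z \<le> r \<and>
        g (y, z) = (w, i, j, k)"
        using dist(1-3)[OF yz] ineq by (simp add: g_def cM)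
    qed
    have "{p \<in> ?P. g p = (w, i, j, k)}
        = {(y, z). y \<in> words q n \<and> z \<in> words q n \<and> mset (pos_word v y z) = M (w, i, j, k)}"
      using iff by blast
    then have "real (card {p \<in> ?P. g p = (w, i, j, k)})
       = fact n * (\<Prod>t\<in>UNIV. real (pos_weight q t) ^ count (M (w, i, j, k)) t
                         / fact (count (M (w, i, j, k)) t))"
      using card_pos_mset[OF v sM] by simp
    also have "\<dots> = fact n * real (q - 2) ^ k *
         (real (q - 1) ^ j * real (q - 1) ^ k * real (q - 1) ^ (w - (j + k)) * real (q - 1) ^ (i - (j + k))) /
         (fact j * fact k * fact (w - (j + k)) * fact (i - (j + k)) * fact (n + (j + k) - w - i))"
      unfolding UNIV_pos by (simp add: cM power_mult_distrib mult_ac del: of_nat_diff)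
    \<comment> \<open>Each coordinate not of kind \<open>PNone\<close> carries one factor
      \<open>q - 1\<close>, and there are \<open>w + i - (j + k)\<close> of them.\<close>
    also have "real (q - 1) ^ j * real (q - 1) ^ k * real (q - 1) ^ (w - (j + k)) * real (q - 1) ^ (i - (j + k))
        = real (q - 1) ^ (w + i - (j + k))"
    proof -
      have "w + i - (j + k) = j + k + (w - (j + k)) + (i - (j + k))" using ineq by simp
      then show ?thesis by (simp only: power_add)
    qed
    finally show ?thesis unfolding F_def .
  qed
  have finT: "finite T" unfolding T_def by auto
  have "real (card ?P) = (\<Sum>p\<in>?P. 1)" by simp
  also have "\<dots> = (\<Sum>t\<in>T. \<Sum>p\<in>{p \<in> ?P. g p = t}. 1)"
    using finP finT gT by (intro sum.group[symmetric]) auto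
  also have "\<dots> = (\<Sum>(w, i, j, k)\<in>T. F w i j k)"
  proof (rule sum.cong)
    fix t assume "t \<in> T"
    then show "(\<Sum>p\<in>{p \<in> ?P. g p = t}. 1) = (case t of (w, i, j, k) \<Rightarrow> F w i j k)"
      using cell by (cases t) auto
  qed simp
  also have "\<dots> = (\<Sum>w=1..r. \<Sum>i=1..r. \<Sum>j=0..min w i. \<Sum>k=b w i j..min w i - j. F w i j k)"
    unfolding T_def by (simp add: sum.Sigma)
  also have "\<dots> = ?R" unfolding F_def b_def Let_def ..
  finally show ?thesis .
qed

section \<open>The graph of close words\<close>

definition close_words :: "nat \<Rightarrow> 'a list \<Rightarrow> 'a list \<Rightarrow> bool" where
  "close_words r x y \<longleftrightarrow> x \<noteq> y \<and> length x = length y \<and> hamming_dist x y \<le> r"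

text \<open>This is where equal lengths in \<open>close_words\<close> matter:
  \<open>hamming_dist\<close> inspects only the positions of its first argument.\<close>

lemma close_words_sym: "close_words r x y \<Longrightarrow> close_words r y x"
  unfolding close_words_def by (simp only: hamming_dist_commute[of y x]) auto

lemma card_close_words:
  assumes v: "v \<in> words q n"
  shows "card {u \<in> words q n. close_words r v u} + 1 = V q n r"
proof -
  have "{u \<in> words q n. hamming_dist v u \<le> r} = insert v {u \<in> words q n. close_words r v u}"
    using v by (auto simp: close_words_def hamming_dist_self length_words)
  moreover have "v \<notin> {u \<in> words q n. close_words r v u}" by (simp add: close_words_def)
  ultimately show ?thesis
    using card_ball[OF v, of r] finite_words by (simp add: card_insert_if)
qed

text \<open>The quadruple sum in \<open>e\<close> also counts the diagonal pairs, one for each of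
  the \<open>V q n r - 1\<close> neighbours of \<open>v\<close>; the subtracted term removes exactly
  these.\<close>

lemma e_eq_card:
  assumes v: "v \<in> words q n"
  shows "6 * e q n r = real (card {(x, y). x \<in> words q n \<and> y \<in> words q n \<and>
     close_words r v x \<and> close_words r v y \<and> close_words r x y})"
proof -
  let ?P = "{(y, z). y \<in> words q n \<and> z \<in> words q n \<and> hamming_dist v y \<in> {1..r} \<and>
           hamming_dist v z \<in> {1..r} \<and> hamming_dist y z \<le> r}"
  let ?T = "{(x, y). x \<in> words q n \<and> y \<in> words q n \<and>
     close_words r v x \<and> close_words r v y \<and> close_words r x y}"
  let ?D = "{u \<in> words q n. close_words r v u}"
  have nb: "hamming_dist v y \<in> {1..r} \<longleftrightarrow> close_words r v y" if "y \<in> words q n" for y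
  proof -
    have l: "length v = length y" using that v length_words by metis
    then show ?thesis using hamming_dist_eq_0[OF l] by (auto simp: close_words_def)
  qed
  have len: "length y = length z" if "y \<in> words q n" "z \<in> words q n" for y z
    using that length_words by metis
  have "?P = ?T \<union> (\<lambda>u. (u, u)) ` ?D"
  proof (intro equalityI subsetI)
    fix p assume p: "p \<in> ?P"
    obtain y z where yz: "p = (y, z)" by (cases p)
    show "p \<in> ?T \<union> (\<lambda>u. (u, u)) ` ?D"
    proof (cases "y = z")
      case True
      then show ?thesis using p nb[of y] unfolding yz by auto
    next
      case False
      then have "close_words r y z" using p len[of y z] unfolding yz close_words_def by auto
      then show ?thesis using p nb[of y] nb[of z] unfolding yz by auto
    qed
  next
    fix p assume p: "p \<in> ?T \<union> (\<lambda>u. (u, u)) ` ?D"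
    then obtain y z where yz: "p = (y, z)" "y \<in> words q n" "z \<in> words q n" by auto
    show "p \<in> ?P"
      using p nb[of y] nb[of z] yz by (auto simp: close_words_def[of r y z] hamming_dist_self)
  qed
  moreover have "?T \<inter> (\<lambda>u. (u, u)) ` ?D = {}" by (auto simp: close_words_def)
  moreover have "finite ?T"
    by (rule finite_subset[of _ "words q n \<times> words q n"]) (auto simp: finite_words)
  moreover have "finite ?D" using finite_words by auto
  ultimately have "card ?P = card ?T + card ?D"
    by (simp add: card_Un_disjoint card_image inj_on_def)
  then have "real (card ?P) = real (card ?T) + (real (V q n r) - 1)"
    using card_close_words[OF v, of r] by simp
  moreover have "e q n r = 1 / 6 * real (card ?P) - (real (V q n r) - 1) / 6"
    unfolding card_close_pairs[OF v] e_def ..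
  moreover have "6 * a = t" if "s = t + u" "a = 1 / 6 * s - u / 6" for a s t u :: real
    using that by (simp add: field_simps)
  ultimately show ?thesis by blast
qed

subsection \<open>Codes of exact minimum distance\<close>

lemma min_dist_eqI:
  assumes "finite C" "x \<in> C" "y \<in> C" "x \<noteq> y" "hamming_dist x y = m"
    and "\<And>x y. x \<in> C \<Longrightarrow> y \<in> C \<Longrightarrow> x \<noteq> y \<Longrightarrow> m \<le> hamming_dist x y"
  shows "min_dist C = m"
  unfolding min_dist_def
proof (rule Min_eqI)
  show "finite {hamming_dist x y |x y. x \<in> C \<and> y \<in> C \<and> x \<noteq> y}"
    by (rule finite_subset[of _ "(\<lambda>(x, y). hamming_dist x y) ` (C \<times> C)"]) (use assms(1) in auto)
qed (use assms in auto)

lemma min_dist_attained: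
  assumes "finite C" "2 \<le> card C"
  obtains x y where "x \<in> C" "y \<in> C" "x \<noteq> y" "hamming_dist x y = min_dist C"
    "\<And>x y. x \<in> C \<Longrightarrow> y \<in> C \<Longrightarrow> x \<noteq> y \<Longrightarrow> min_dist C \<le> hamming_dist x y"
proof -
  let ?D = "{hamming_dist x y |x y. x \<in> C \<and> y \<in> C \<and> x \<noteq> y}"
  have fin: "finite ?D"
    by (rule finite_subset[of _ "(\<lambda>(x, y). hamming_dist x y) ` (C \<times> C)"]) (use assms(1) in auto)
  have "\<not> is_singleton C" "C \<noteq> {}" using assms by (auto simp: is_singleton_altdef)
  then obtain x y where "x \<in> C" "y \<in> C" "x \<noteq> y" unfolding is_singleton_def by blast
  then have "?D \<noteq> {}" by blast
  then have "min_dist C \<in> ?D" unfolding min_dist_def using fin by (rule Min_in[rotated])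
  moreover have "min_dist C \<le> hamming_dist x y" if "x \<in> C" "y \<in> C" "x \<noteq> y" for x y
    unfolding min_dist_def using fin that by (intro Min_le) auto
  ultimately show ?thesis using that by auto
qed

text \<open>Moving one end of a closest pair one step towards the other lowers the minimum distance by one.\<close>

lemma code_decrease_min_dist:
  assumes C: "C \<subseteq> words q n" "2 \<le> card C" "2 \<le> min_dist C"
  obtains C' where "C' \<subseteq> words q n" "card C' = card C" "min_dist C' = min_dist C - 1"
proof -
  have finC: "finite C" using C finite_words finite_subset by blast
  obtain x y where xy: "x \<in> C" "y \<in> C" "x \<noteq> y" "hamming_dist x y = min_dist C"
    and min: "\<And>x y. x \<in> C \<Longrightarrow> y \<in> C \<Longrightarrow> x \<noteq> y \<Longrightarrow> min_dist C \<le> hamming_dist x y"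
    using min_dist_attained[OF finC C(2)] by metis
  have len: "length z = n" if "z \<in> C" for z using that C length_words by auto
  have "hamming_dist x y \<noteq> 0" using xy C by simp
  then obtain i where i: "i < n" "x ! i \<noteq> y ! i"
    using len xy unfolding hamming_dist_def by (metis (mono_tags, lifting) Collect_empty_eq card.empty)
  define x' where "x' = x[i := y ! i]"
  have lx': "length x' = n" unfolding x'_def using len xy by simp
  have "{j. j < length x' \<and> x' ! j \<noteq> y ! j} = {j. j < length x \<and> x ! j \<noteq> y ! j} - {i}"
    using i xy len unfolding x'_def by (auto simp: nth_list_update)
  then have x'y: "hamming_dist x' y = min_dist C - 1"
    using i xy(4) len[OF xy(1)] unfolding hamming_dist_def by (simp add: card_Diff_singleton)
  have "{j. j < length x \<and> x ! j \<noteq> x' ! j} = {i}"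
    using i xy len unfolding x'_def by (auto simp: nth_list_update)
  then have xx': "hamming_dist x x' = 1" unfolding hamming_dist_def by simp
  \<comment> \<open>The new word is at distance 1 from \<open>x\<close>, too close to be a codeword
    already, so the exchange keeps the size of the code.\<close>
  have x'C: "x' \<notin> C"
  proof
    assume "x' \<in> C"
    moreover have "x \<noteq> x'" using xx' by (auto simp: hamming_dist_self)
    ultimately have "min_dist C \<le> 1" using min[OF xy(1), of x'] xx' by simp
    then show False using C(3) by simp
  qed
  \<comment> \<open>By the triangle inequality, replacing \<open>x\<close> by \<open>x'\<close>
    loses at most the one step between them.\<close>
  have far: "min_dist C - 1 \<le> hamming_dist x' z" if z: "z \<in> C - {x}" for z
  proof -
    have "min_dist C \<le> hamming_dist x z" using min[OF xy(1), of z] z by auto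
    also have "\<dots> \<le> hamming_dist x x' + hamming_dist x' z"
      by (rule hamming_dist_triangle) (use len xy z lx' in auto)
    finally show ?thesis using xx' by simp
  qed
  have yi: "y ! i < q" using i len[OF xy(2)] xy(2) C(1) unfolding words_def by (auto simp: subset_iff)
  have xw: "length x = n" "set x \<subseteq> {..<q}" using xy(1) C(1) unfolding words_def by auto
  have "set x' \<subseteq> insert (y ! i) (set x)" unfolding x'_def by (rule set_update_subset_insert)
  then have x'w: "x' \<in> words q n" using yi xw lx' unfolding words_def by auto
  have C'1: "insert x' (C - {x}) \<subseteq> words q n" using x'w C(1) by auto
  have C'2: "card (insert x' (C - {x})) = card C"
    using x'C xy(1) finC C(2) by (simp add: card_Diff_singleton)
  have "min_dist (insert x' (C - {x})) = min_dist C - 1"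
  proof (rule min_dist_eqI)
    show "finite (insert x' (C - {x}))" using finC by simp
    show "x' \<in> insert x' (C - {x})" "y \<in> insert x' (C - {x})" using xy by auto
    show "x' \<noteq> y" using x'C xy by auto
    show "hamming_dist x' y = min_dist C - 1" by (rule x'y)
    fix s t assume st: "s \<in> insert x' (C - {x})" "t \<in> insert x' (C - {x})" "s \<noteq> t"
    consider "s = x'" "t \<in> C - {x}" | "t = x'" "s \<in> C - {x}" | "s \<in> C" "t \<in> C" using st by auto
    then show "min_dist C - 1 \<le> hamming_dist s t"
    proof cases
      case 1
      then show ?thesis using far by simp
    next
      case 2
      then have "hamming_dist s t = hamming_dist x' s"
        using hamming_dist_commute[of s x'] len lx' by auto
      then show ?thesis using far 2 by simp
    next
      case 3
      then show ?thesis using min st by (meson diff_le_self le_trans)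
    qed
  qed
  then show ?thesis using that C'1 C'2 by blast
qed

text \<open>Induction on the surplus \<open>k\<close>: lowering the minimum distance one unit at a
  time, at constant size, reaches the exact value that \<open>A\<close> demands.\<close>

lemma card_le_A_of_min_dist:
  assumes "0 < d" "C \<subseteq> words q n" "2 \<le> card C" "min_dist C = d + k"
  shows "card C \<le> A q n d"
  using assms
proof (induction k arbitrary: C)
  case 0
  have "{card C |C. C \<subseteq> words q n \<and> 2 \<le> card C \<and> min_dist C = d} \<subseteq> card ` Pow (words q n)"
    by auto
  then have "finite {card C |C. C \<subseteq> words q n \<and> 2 \<le> card C \<and> min_dist C = d}"
    by (rule finite_subset) (simp add: finite_words)
  then show ?case unfolding A_def using 0 by (intro Max_ge) auto
next
  case (Suc k)
  then obtain C' where "C' \<subseteq> words q n" "card C' = card C" "min_dist C' = min_dist C - 1"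
    using code_decrease_min_dist[of C q n] by auto
  then show ?case using Suc.IH[of C'] Suc.prems by simp
qed

lemma card_le_A:
  assumes "0 < d" "C \<subseteq> words q n" "2 \<le> card C"
    and far: "\<And>x y. x \<in> C \<Longrightarrow> y \<in> C \<Longrightarrow> x \<noteq> y \<Longrightarrow> d \<le> hamming_dist x y"
  shows "card C \<le> A q n d"
proof -
  have "finite C" using assms(2) finite_words finite_subset by blast
  then have "d \<le> min_dist C" using min_dist_attained[of C] assms(3) far by metis
  then show ?thesis using card_le_A_of_min_dist[of d C q n "min_dist C - d"] assms by simp
qed

text \<open>Two constant words at distance \<open>n\<close> form a code. This covers independent
  sets with fewer than two words, which are not admissible in the definition of
  \<open>A\<close>.\<close>

lemma A_ge_2:
  assumes "0 < d" "d \<le> n" "2 \<le> q"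
  shows "2 \<le> A q n d"
proof -
  let ?x = "replicate n (0::nat)" and ?y = "replicate n (1::nat)"
  have ne: "?x \<noteq> ?y" using assms by simp
  have "{i. i < length ?x \<and> ?x ! i \<noteq> ?y ! i} = {..<n}" "{i. i < length ?y \<and> ?y ! i \<noteq> ?x ! i} = {..<n}"
    by auto
  then have xy: "hamming_dist ?x ?y = n" "hamming_dist ?y ?x = n" by (simp_all only: hamming_dist_def card_lessThan)
  have "card {?x, ?y} \<le> A q n d"
  proof (rule card_le_A)
    show "{?x, ?y} \<subseteq> words q n" using assms unfolding words_def by auto
    show "2 \<le> card {?x, ?y}" using ne by simp
    fix s t assume "s \<in> {?x, ?y}" "t \<in> {?x, ?y}" "s \<noteq> t"
    then have "hamming_dist s t = n" using xy by auto
    then show "d \<le> hamming_dist s t" using assms by simp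
  qed (rule assms)
  then show ?thesis using ne by simp
qed

section \<open>The bound for codes\<close>

theorem theorem14:
  fixes q n d :: nat
  assumes "0 < n" and "0 < d" and "d \<le> n" and "2 \<le> q"
  shows "real (A q n d) \<ge>
    real q ^ n / real (V q n (d - 1)) *
    ((log 2 (real (V q n (d - 1))) - log 2 (sqrt (e q n (d - 1)))) / 10)"
proof -
  define r where "r = d - 1"
  \<comment> \<open>If \<open>e\<close> vanishes, \<open>log 2 (sqrt 0)\<close> and
    \<open>log 2 (sqrt 1)\<close> are both 0, so 1 can replace it without changing the bound.
    Otherwise \<open>6 * e q n r\<close> is a positive integer, hence \<open>E\<close> is at least
    1/6.\<close>
  define E where "E = (if e q n r = 0 then 1 else e q n r)"
  \<comment> \<open>Some vertex is needed to read off that \<open>6 * e q n r\<close> is a natural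
    number and that \<open>V q n r\<close> is positive.\<close>
  have "replicate n 0 \<in> words q n" using assms unfolding words_def by auto
  then have ecard: "\<exists>c::nat. 6 * e q n r = real c" and V0: "0 < V q n r"
    using e_eq_card card_close_words by (blast, metis add_gr_0 zero_less_one)
  then obtain c :: nat where c: "6 * e q n r = real c" by blast
  have E6: "1/6 \<le> E"
  proof (cases "c = 0")
    case False
    then have "1 \<le> real c" by simp
    then show ?thesis unfolding E_def using c by auto
  qed (use c E_def in simp)
  have eE: "e q n r \<le> E" unfolding E_def by simp
  have logE: "log 2 (sqrt (e q n r)) = log 2 (sqrt E)" unfolding E_def by (simp add: log_def)
  have "\<exists>S\<in>indep_sets (close_words r) (words q n). real (card (words q n)) / real (V q n r) *
      ((log 2 (real (V q n r)) - log 2 (sqrt E)) / 10) \<le> real (card S)"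
  proof (rule locally_sparse_indep_set)
    show "finite (words q n)" by (rule finite_words)
    show "\<not> close_words r x x" for x :: "nat list" by (simp add: close_words_def)
    show "close_words r y x" if "close_words r x y" for x y :: "nat list"
      using that by (rule close_words_sym)
    show "card {u \<in> words q n. close_words r v u} < V q n r" if "v \<in> words q n" for v
      using card_close_words[OF that, of r] by simp
    show "real (card {(x, y). x \<in> words q n \<and> y \<in> words q n \<and> close_words r v x \<and>
        close_words r v y \<and> close_words r x y}) \<le> 6 * E" if "v \<in> words q n" for v
      using e_eq_card[OF that, of r] eE by simp
  qed (use E6 V0 in auto)
  then obtain S where S: "S \<in> indep_sets (close_words r) (words q n)"
    and bound: "real (card (words q n)) / real (V q n r) *
      ((log 2 (real (V q n r)) - log 2 (sqrt E)) / 10) \<le> real (card S)" by blast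
  have "card S \<le> A q n d"
  proof (cases "2 \<le> card S")
    case True
    show ?thesis
    proof (rule card_le_A)
      fix x y assume xy: "x \<in> S" "y \<in> S" "x \<noteq> y"
      then have w: "x \<in> words q n" "y \<in> words q n" "\<not> close_words r x y"
        using S unfolding indep_sets_def by auto
      then have "length x = length y" using length_words by metis
      then show "d \<le> hamming_dist x y" using w xy unfolding close_words_def r_def by auto
    qed (use True S assms in \<open>auto simp: indep_sets_def\<close>)
  next
    case False
    then show ?thesis using A_ge_2[OF assms(2-4)] by simp
  qed
  then show ?thesis using bound unfolding card_words logE[symmetric] r_def by simp
qed

end
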